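(* Let $B$ be a finite skew brace and let $I,J$ be ideals of $B$ such that $B=I\circ J$ is the internal central product of $I$ and $J$. Then $B$ is isomorphic, as a skew brace, to the external central product of $I$ and $J$ obtained by amalgamating the common central ideal $I\cap J$ through the identity map $\operatorname{id}:I\cap J\to I\cap J$, that is, $$B\simeq (I\times J)/\{(i,-i)\mid i\in I\cap J\}.$$
   Context: A skew brace is a triple $(B,+,\cdot)$ such that $(B,+)$ and $(B,\cdot)$ are groups (neither assumed abelian) and $a\cdot(b+c)=a\cdot b-a+a\cdot c$ for all $a,b,c\in B$; both groups have the same identity, denoted $0$. An isomorphism of skew braces is a bijection that is a homomorphism for both operations; the direct product of skew braces has componentwise operations. For $b\in B$ put $\lambda_b(a)=-b+ba$. A subset $I\subseteq B$ is an ideal if $(I,+)\trianglelefteq(B,+)$, $(I,\cdot)\trianglelefteq(B,\cdot)$ and $\lambda_b(I)\subseteq I$ for all $b\in B$; then $I$ is a skew brace under the restricted operations, $a+I=aI$ for all $a\in B$, and $B/I$ is a skew brace. The center $Z(B)$ is the set of $z\in B$ that are central in both $(B,+)$ and $(B,\cdot)$ and satisfy $\lambda_z=\operatorname{id}_B$; it is an ideal. An ideal $I$ of $B$ is central if $I\le Z(B)$. For $a,b\in B$ let $a*b=-a+ab-b$, and for $X,Y\subseteq B$ let $X*Y$ be the additive subgroup generated by all $x*y$, $x\in X$, $y\in Y$. For ideals $I,J$ of $B$, $B$ is the internal central product of $I$ and $J$, written $B=I\circ J$, if $B=I+J$, $[I,J]_+=0$ (additive commutators of elements of $I$ with elements of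 $J$ vanish), $I*J=J*I=0$, and $I\cap J\le Z(B)$. For skew braces $B_1,B_2$ with central ideals $I_1\le Z(B_1)$, $I_2\le Z(B_2)$ and a skew brace isomorphism $\alpha:I_1\to I_2$, the external central product amalgamating $I_1$ and $I_2$ through $\alpha$ is $B_1\circ_\alpha B_2=(B_1\times B_2)/N_\alpha$ with $N_\alpha=\{(i,-\alpha(i))\mid i\in I_1\}$, which is a central ideal of $B_1\times B_2$. *)

theory Defs
  imports "HOL-Algebra.Chinese_Remainder" "HOL-Algebra.Generated_Groups"
begin

text \<open>
  A skew brace is carried by the record type of rings: the multiplicative group is the record
  itself and the additive group is its \<^const>\<open>add_monoid\<close>.  None of the ring axioms is assumed;
  in particular addition need not be commutative.  The constants \<^const>\<open>a_inv\<close>, \<^const>\<open>a_minus\<close>,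
  \<^const>\<open>set_add\<close>, \<^const>\<open>RDirProd\<close> and \<^const>\<open>FactRing\<close> used below depend on the record operations only.
\<close>

locale skew_brace =
  fixes B (structure)
  assumes add_group: "group (add_monoid B)"
    and mult_group: "group B"
    and brace_distrib:
      "\<lbrakk>a \<in> carrier B; b \<in> carrier B; c \<in> carrier B\<rbrakk>
        \<Longrightarrow> a \<otimes> (b \<oplus> c) = (a \<otimes> b \<ominus> a) \<oplus> (a \<otimes> c)"

lemma (in skew_brace) one_eq_zero: "\<one> = \<zero>"
proof -
  interpret A: group "add_monoid B" by (rule add_group)
  interpret M: group B by (rule mult_group)
  have z: "\<zero> \<in> carrier B" using A.one_closed by simp
  have "\<one> \<otimes> (\<one> \<oplus> \<zero>) = (\<one> \<otimes> \<one> \<ominus> \<one>) \<oplus> (\<one> \<otimes> \<zero>)"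
    by (rule brace_distrib) (use z in auto)
  moreover have "\<one> \<oplus> \<zero> = \<one>" using A.r_one[of \<one>] by simp
  moreover have "\<one> \<ominus> \<one> = \<zero>" using A.r_inv[of \<one>] by (simp add: a_minus_def a_inv_def)
  moreover have "\<zero> \<oplus> \<zero> = \<zero>" using A.r_one[of \<zero>] z by simp
  ultimately show ?thesis using z by simp
qed

definition skew_brace_iso ::
  "('a, 'm) ring_scheme \<Rightarrow> ('b, 'n) ring_scheme \<Rightarrow> ('a \<Rightarrow> 'b) set"
  where "skew_brace_iso A B = iso (add_monoid A) (add_monoid B) \<inter> iso A B"

definition is_skew_brace_iso ::
  "('a, 'm) ring_scheme \<Rightarrow> ('b, 'n) ring_scheme \<Rightarrow> bool"
  where "is_skew_brace_iso A B \<longleftrightarrow> skew_brace_iso A B \<noteq> {}"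

definition brace_lambda :: "('a, 'm) ring_scheme \<Rightarrow> 'a \<Rightarrow> 'a \<Rightarrow> 'a"
  where "brace_lambda B b a = \<ominus>\<^bsub>B\<^esub> b \<oplus>\<^bsub>B\<^esub> (b \<otimes>\<^bsub>B\<^esub> a)"

definition brace_ideal :: "'a set \<Rightarrow> ('a, 'm) ring_scheme \<Rightarrow> bool"
  where "brace_ideal I B \<longleftrightarrow>
    I \<lhd> add_monoid B \<and> I \<lhd> B \<and> (\<forall>b \<in> carrier B. brace_lambda B b ` I \<subseteq> I)"

definition sub_brace :: "('a, 'm) ring_scheme \<Rightarrow> 'a set \<Rightarrow> ('a, 'm) ring_scheme"
  where "sub_brace B I = B\<lparr>carrier := I\<rparr>"

definition brace_center :: "('a, 'm) ring_scheme \<Rightarrow> 'a set"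
  where "brace_center B =
    {z \<in> carrier B. \<forall>x \<in> carrier B.
       z \<oplus>\<^bsub>B\<^esub> x = x \<oplus>\<^bsub>B\<^esub> z \<and> z \<otimes>\<^bsub>B\<^esub> x = x \<otimes>\<^bsub>B\<^esub> z \<and> brace_lambda B z x = x}"

definition central_ideal :: "'a set \<Rightarrow> ('a, 'm) ring_scheme \<Rightarrow> bool"
  where "central_ideal I B \<longleftrightarrow> brace_ideal I B \<and> I \<subseteq> brace_center B"

definition brace_star :: "('a, 'm) ring_scheme \<Rightarrow> 'a \<Rightarrow> 'a \<Rightarrow> 'a"
  where "brace_star B a b = (\<ominus>\<^bsub>B\<^esub> a \<oplus>\<^bsub>B\<^esub> (a \<otimes>\<^bsub>B\<^esub> b)) \<ominus>\<^bsub>B\<^esub> b"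

definition star_product :: "('a, 'm) ring_scheme \<Rightarrow> 'a set \<Rightarrow> 'a set \<Rightarrow> 'a set"
  where "star_product B X Y = generate (add_monoid B) {brace_star B x y | x y. x \<in> X \<and> y \<in> Y}"

definition add_commutator :: "('a, 'm) ring_scheme \<Rightarrow> 'a \<Rightarrow> 'a \<Rightarrow> 'a"
  where "add_commutator B a b = ((a \<oplus>\<^bsub>B\<^esub> b) \<ominus>\<^bsub>B\<^esub> a) \<ominus>\<^bsub>B\<^esub> b"

definition internal_central_product ::
  "('a, 'm) ring_scheme \<Rightarrow> 'a set \<Rightarrow> 'a set \<Rightarrow> bool"
  where "internal_central_product B I J \<longleftrightarrow>
    brace_ideal I B \<and> brace_ideal J B \<and>
    carrier B = I <+>\<^bsub>B\<^esub> J \<and>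
    (\<forall>i \<in> I. \<forall>j \<in> J. add_commutator B i j = \<zero>\<^bsub>B\<^esub>) \<and>
    star_product B I J = {\<zero>\<^bsub>B\<^esub>} \<and> star_product B J I = {\<zero>\<^bsub>B\<^esub>} \<and>
    I \<inter> J \<subseteq> brace_center B"

definition amalgamation_data ::
  "('a, 'm) ring_scheme \<Rightarrow> ('b, 'n) ring_scheme \<Rightarrow> 'a set \<Rightarrow> 'b set \<Rightarrow> ('a \<Rightarrow> 'b) \<Rightarrow> bool"
  where "amalgamation_data B1 B2 I1 I2 \<alpha> \<longleftrightarrow>
    skew_brace B1 \<and> skew_brace B2 \<and> central_ideal I1 B1 \<and> central_ideal I2 B2 \<and>
    \<alpha> \<in> skew_brace_iso (sub_brace B1 I1) (sub_brace B2 I2)"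

definition amalgamation_ideal ::
  "('b, 'n) ring_scheme \<Rightarrow> 'a set \<Rightarrow> ('a \<Rightarrow> 'b) \<Rightarrow> ('a \<times> 'b) set"
  where "amalgamation_ideal B2 I1 \<alpha> = {(i, \<ominus>\<^bsub>B2\<^esub> \<alpha> i) | i. i \<in> I1}"

text \<open>
  The carrier of \<open>B Quot N\<close> consists of the additive cosets \<open>N + a\<close>.  The product of two cosets is,
  by definition, the union of the cosets \<open>N + a b\<close> over all representatives \<open>a\<close>, \<open>b\<close>; for an ideal \<open>N\<close>
  of a skew brace these cosets all coincide, so this is the usual product of the quotient skew brace.
  The amalgamated ideal \<open>I2\<close> is determined as the image of \<open>I1\<close> under \<open>\<alpha>\<close>.
\<close>

definition external_central_product ::
  "('a, 'm) ring_scheme \<Rightarrow> ('b, 'n) ring_scheme \<Rightarrow> 'a set \<Rightarrow> ('a \<Rightarrow> 'b) \<Rightarrow> ('a \<times> 'b) set ring"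
  where "external_central_product B1 B2 I1 \<alpha> = RDirProd B1 B2 Quot amalgamation_ideal B2 I1 \<alpha>"

end

theory Submission
  imports Defs
begin

text \<open>
  In \<open>B = I \<circ> J\<close> the hypotheses \<open>[I,J]\<^sub>+ = I * J = J * I = 0\<close> say that \<open>ij = i + j = j + i = ji\<close>
  for \<open>i \<in> I\<close> and \<open>j \<in> J\<close>.  Hence \<open>(i, j) \<mapsto> i + j\<close> is a homomorphism from \<open>I \<times> J\<close> onto \<open>B\<close> for both
  operations, with kernel \<open>{(i, -i) | i \<in> I \<inter> J}\<close>, and the first isomorphism theorem applies.
\<close>

lemma add_monoid_sub_brace [simp]:
  "add_monoid (sub_brace B S) = (add_monoid B)\<lparr>carrier := S\<rparr>"
  by (simp add: sub_brace_def)

lemma sub_brace_simps [simp]: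
  "carrier (sub_brace B S) = S"
  "mult (sub_brace B S) = mult B" "one (sub_brace B S) = one B"
  "add (sub_brace B S) = add B" "zero (sub_brace B S) = zero B"
  by (simp_all add: sub_brace_def)

lemma RDirProd_simps:
  "(a, b) \<otimes>\<^bsub>RDirProd R S\<^esub> (c, d) = (a \<otimes>\<^bsub>R\<^esub> c, b \<otimes>\<^bsub>S\<^esub> d)"
  "(a, b) \<oplus>\<^bsub>RDirProd R S\<^esub> (c, d) = (a \<oplus>\<^bsub>R\<^esub> c, b \<oplus>\<^bsub>S\<^esub> d)"
  by (simp_all add: RDirProd_def DirProd_def monoid.defs)

text \<open>Two elements have the same image exactly when their quotient lies in the kernel. This
  lets cosets of the kernel be treated as fibres of \<open>h\<close>.\<close>

lemma (in group_hom) rcoset_kernel: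
  assumes x: "x \<in> carrier G"
  shows "kernel G H h #> x = {z \<in> carrier G. h z = h x}"
proof (intro equalityI subsetI)
  fix z assume "z \<in> kernel G H h #> x"
  with x show "z \<in> {z \<in> carrier G. h z = h x}"
    by (auto simp: r_coset_def kernel_def)
next
  fix z assume z: "z \<in> {z \<in> carrier G. h z = h x}"
  then have "z \<otimes> inv x \<in> kernel G H h" using x by (auto simp: kernel_def)
  moreover have "z = z \<otimes> inv x \<otimes> x" using z x by (simp add: G.m_assoc)
  ultimately show "z \<in> kernel G H h #> x" unfolding r_coset_def by blast
qed

text \<open>The isomorphism runs from \<open>B\<close> to the quotient and sends a point to its
  fibre under \<open>f\<close>, so no independence of coset representatives has to be checked. The
  additive cosets of the kernel are exactly these fibres, and since \<open>f\<close> respects both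
  operations, so does the fibre map.\<close>

lemma first_isomorphism_brace:
  fixes P :: "('a, 'm) ring_scheme" and B :: "('b, 'n) ring_scheme"
  assumes add_hom: "group_hom (add_monoid P) (add_monoid B) f"
    and mult_hom: "f \<in> hom P B"
    and P_closed: "\<And>x y. x \<in> carrier P \<Longrightarrow> y \<in> carrier P \<Longrightarrow> x \<otimes>\<^bsub>P\<^esub> y \<in> carrier P"
    and surj: "f ` carrier P = carrier B"
  shows "is_skew_brace_iso B (P Quot a_kernel P B f)"
proof -
  interpret F: group_hom "add_monoid P" "add_monoid B" f by (rule add_hom)
  let ?N = "a_kernel P B f"
  let ?g = "\<lambda>b. {x \<in> carrier P. f x = b}"
  have coset: "?N +>\<^bsub>P\<^esub> x = ?g (f x)" if "x \<in> carrier P" for x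
    using F.rcoset_kernel[of x] that by (simp add: a_kernel_def a_r_coset_def)
  have cosets: "a_rcosets\<^bsub>P\<^esub> ?N = ?g ` carrier B"
    by (auto simp: A_RCOSETS_def' coset image_image simp flip: surj)
  have rep: "\<exists>x \<in> carrier P. f x = b" if "b \<in> carrier B" for b
    using that by (auto simp flip: surj)
  \<comment> \<open>Injectivity: each fibre is nonempty because \<open>f\<close> is onto, and any
    member of it determines the point below.\<close>
  have bij: "bij_betw ?g (carrier B) (a_rcosets\<^bsub>P\<^esub> ?N)"
    unfolding bij_betw_def cosets inj_on_def using rep by blast
  have add: "?g (b \<oplus>\<^bsub>B\<^esub> c) = ?g b <+>\<^bsub>P\<^esub> ?g c" if "b \<in> carrier B" "c \<in> carrier B" for b c
  proof -
    from that obtain x y where xy: "x \<in> carrier P" "f x = b" "y \<in> carrier P" "f y = c"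
      using rep by meson
    have "(?N +>\<^bsub>P\<^esub> x) <+>\<^bsub>P\<^esub> (?N +>\<^bsub>P\<^esub> y) = ?N +>\<^bsub>P\<^esub> (x \<oplus>\<^bsub>P\<^esub> y)"
      using normal.rcos_sum[OF F.normal_kernel, of x y] xy
      by (simp add: a_kernel_def a_r_coset_def set_add_def)
    then show ?thesis
      using xy F.hom_mult[of x y] F.G.m_closed[of x y] by (simp add: coset)
  qed
  have mult: "?g (b \<otimes>\<^bsub>B\<^esub> c) = rcoset_mult P ?N (?g b) (?g c)"
    if "b \<in> carrier B" "c \<in> carrier B" for b c
  proof -
    \<comment> \<open>\<open>rcoset_mult\<close> is a union over all pairs of representatives. Every
      set in the union is the same fibre, and there is at least one pair, so the union is that
      fibre.\<close>
    have "?N +>\<^bsub>P\<^esub> (x \<otimes>\<^bsub>P\<^esub> y) = ?g (b \<otimes>\<^bsub>B\<^esub> c)" if "x \<in> ?g b" "y \<in> ?g c" for x y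
      using that P_closed[of x y] hom_mult[OF mult_hom, of x y] by (auto simp: coset)
    moreover have "?g b \<noteq> {}" "?g c \<noteq> {}" using that rep by auto
    ultimately show ?thesis unfolding rcoset_mult_def by auto
  qed
  have "?g \<in> iso (add_monoid B) (add_monoid (P Quot ?N))"
    using bij add by (auto simp: iso_def FactRing_def hom_def bij_betw_def)
  moreover have "?g \<in> iso B (P Quot ?N)"
    using bij mult by (auto simp: iso_def FactRing_def hom_def bij_betw_def)
  ultimately show ?thesis
    unfolding is_skew_brace_iso_def skew_brace_iso_def by blast
qed

context skew_brace
begin

text \<open>Group facts about addition become available in ring notation, and the prefix
  \<open>add\<close> keeps them apart from those about multiplication.\<close>

sublocale add: group "add_monoid B"
  rewrites "carrier (add_monoid B) = carrier B"
    and "mult (add_monoid B) = add B"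
    and "one (add_monoid B) = zero B"
    and "m_inv (add_monoid B) = a_inv B"
  by (rule add_group) (auto simp: a_inv_def)

sublocale group B
  by (rule mult_group)

text \<open>Restriction leaves \<open>\<oplus>\<close> and \<open>\<otimes>\<close> untouched, but
  \<open>a_inv\<close> is defined by a search through the carrier, so its agreement with negation in
  \<open>B\<close> relies on \<open>S\<close> being an additive subgroup.\<close>

lemma sub_brace_a_inv:
  assumes "subgroup S (add_monoid B)" "x \<in> S"
  shows "\<ominus>\<^bsub>sub_brace B S\<^esub> x = \<ominus> x"
  using add.m_inv_consistent[OF assms] by (simp add: a_inv_def)

lemma brace_lambda_sub_brace:
  assumes "subgroup S (add_monoid B)" "x \<in> S"
  shows "brace_lambda (sub_brace B S) x y = brace_lambda B x y"
  by (simp add: brace_lambda_def sub_brace_a_inv[OF assms])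

lemma skew_brace_sub_brace:
  assumes "subgroup S (add_monoid B)" "subgroup S B"
  shows "skew_brace (sub_brace B S)"
proof (rule skew_brace.intro)
  show "group (add_monoid (sub_brace B S))"
    using subgroup.subgroup_is_group[OF assms(1) add_group] by simp
  show "group (sub_brace B S)"
    using subgroup.subgroup_is_group[OF assms(2) mult_group] by (simp add: sub_brace_def)
next
  fix a b c
  assume "a \<in> carrier (sub_brace B S)" "b \<in> carrier (sub_brace B S)" "c \<in> carrier (sub_brace B S)"
  then have S: "a \<in> S" "b \<in> S" "c \<in> S" by simp_all
  then show "a \<otimes>\<^bsub>sub_brace B S\<^esub> (b \<oplus>\<^bsub>sub_brace B S\<^esub> c) =
    a \<otimes>\<^bsub>sub_brace B S\<^esub> b \<ominus>\<^bsub>sub_brace B S\<^esub> a \<oplus>\<^bsub>sub_brace B S\<^esub> a \<otimes>\<^bsub>sub_brace B S\<^esub> c"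
    using brace_distrib[of a b c] subgroup.subset[OF assms(2)]
    by (auto simp: a_minus_def sub_brace_a_inv[OF assms(1)])
qed

text \<open>Normality passes to the intersection with a subgroup, both ideals are stable under every
  \<open>brace_lambda B b\<close>, and the central conditions now range over fewer elements. The
  roles of \<open>I\<close> and \<open>J\<close> can be exchanged to treat the other factor.\<close>

lemma central_ideal_sub_brace:
  assumes I: "brace_ideal I B" and J: "brace_ideal J B" and center: "I \<inter> J \<subseteq> brace_center B"
  shows "central_ideal (I \<inter> J) (sub_brace B I)"
proof -
  have nI: "I \<lhd> add_monoid B" "I \<lhd> B" and nJ: "J \<lhd> add_monoid B" "J \<lhd> B"
    using I J by (auto simp: brace_ideal_def)
  note sI = nI[THEN normal_imp_subgroup] and sJ = nJ[THEN normal_imp_subgroup]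
  have "I \<inter> J \<lhd> add_monoid (sub_brace B I)"
    using add.normal_Int_subgroup[OF sI(1) nJ(1)] by (simp add: Int_commute)
  moreover have "I \<inter> J \<lhd> sub_brace B I"
    using normal_Int_subgroup[OF sI(2) nJ(2)] by (simp add: Int_commute sub_brace_def)
  moreover have "brace_lambda (sub_brace B I) b ` (I \<inter> J) \<subseteq> I \<inter> J" if "b \<in> I" for b
    using that I J subsetD[OF subgroup.subset[OF sI(2)], of b]
    by (auto simp: brace_lambda_sub_brace[OF sI(1)] brace_ideal_def image_subset_iff)
  moreover have "I \<inter> J \<subseteq> brace_center (sub_brace B I)"
    using center subgroup.subset[OF sI(2)]
    by (fastforce simp: brace_center_def brace_lambda_sub_brace[OF sI(1)])
  ultimately show ?thesis by (simp add: central_ideal_def brace_ideal_def)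
qed

text \<open>The element \<open>brace_star B x y\<close> is one of the generators, hence zero;
  cancelling on both sides in -x + xy - y = 0 gives the claim.\<close>

lemma star_product_trivialD:
  assumes "star_product B X Y = {\<zero>}" "x \<in> X" "y \<in> Y" "x \<in> carrier B" "y \<in> carrier B"
  shows "x \<otimes> y = x \<oplus> y"
proof -
  have "brace_star B x y \<in> star_product B X Y"
    unfolding star_product_def using assms(2,3) by (blast intro: generate.incl)
  then have "(\<ominus> x \<oplus> x \<otimes> y) \<oplus> \<ominus> y = \<zero>"
    using assms(1) by (simp add: brace_star_def a_minus_def)
  then have "\<ominus> x \<oplus> x \<otimes> y = y"
    using assms(4,5) add.inv_solve_right'[of "\<zero>" "\<ominus> x \<oplus> x \<otimes> y" y] by simp
  then show ?thesis
    using assms(4,5) add.inv_solve_left'[of y x "x \<otimes> y"] by simp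
qed

lemma add_commutator_zeroD:
  assumes "add_commutator B x y = \<zero>" "x \<in> carrier B" "y \<in> carrier B"
  shows "x \<oplus> y = y \<oplus> x"
proof -
  have "x \<oplus> y \<oplus> \<ominus> x = y"
    using assms add.inv_solve_right'[of "\<zero>" "x \<oplus> y \<oplus> \<ominus> x" y]
    by (simp add: add_commutator_def a_minus_def)
  then show ?thesis
    using assms add.inv_solve_right'[of y "x \<oplus> y" x] by simp
qed

lemma central_product_iso:
  assumes "internal_central_product B I J"
  shows "is_skew_brace_iso B
    (RDirProd (sub_brace B I) (sub_brace B J) Quot {(i, \<ominus> i) | i. i \<in> I \<inter> J})"
proof -
  let ?P = "RDirProd (sub_brace B I) (sub_brace B J)"
  let ?f = "\<lambda>(i, j). i \<oplus> j"
  have I: "subgroup I (add_monoid B)" "subgroup I B"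
    and J: "subgroup J (add_monoid B)" "subgroup J B"
    and sum: "carrier B = I <+> J"
    and trivial: "\<And>i j. i \<in> I \<Longrightarrow> j \<in> J \<Longrightarrow> add_commutator B i j = \<zero>"
      "star_product B I J = {\<zero>}" "star_product B J I = {\<zero>}"
    using assms by (auto simp: internal_central_product_def brace_ideal_def normal_imp_subgroup)
  note Icarr [simp] = subsetD[OF subgroup.subset[OF I(2)]]
  note Jcarr [simp] = subsetD[OF subgroup.subset[OF J(2)]]
  have I_add: "i \<oplus> i' \<in> I" if "i \<in> I" "i' \<in> I" for i i'
    using subgroup.m_closed[OF I(1), of i i'] that by simp
  have J_add: "j \<oplus> j' \<in> J" if "j \<in> J" "j' \<in> J" for j j'
    using subgroup.m_closed[OF J(1), of j j'] that by simp
  have J_minus: "\<ominus> j \<in> J" if "j \<in> J" for j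
    using subgroup.m_inv_closed[OF J(1), of j] that by (simp add: a_inv_def)
  note I_mult = subgroup.m_closed[OF I(2)] and J_mult = subgroup.m_closed[OF J(2)]
  have comm: "i \<oplus> j = j \<oplus> i" if "i \<in> I" "j \<in> J" for i j
    using add_commutator_zeroD[OF trivial(1)] that by simp
  have IJ: "i \<otimes> j = i \<oplus> j" if "i \<in> I" "j \<in> J" for i j
    using star_product_trivialD[OF trivial(2)] that by simp
  \<comment> \<open>Commutativity brings this to the same right-hand side as \<open>IJ\<close>, so
    the two rules together swap a factor from \<open>I\<close> with one from
    \<open>J\<close>.\<close>
  have JI: "j \<otimes> i = i \<oplus> j" if "i \<in> I" "j \<in> J" for i j
    using star_product_trivialD[OF trivial(3)] that by (simp add: comm[of i j])
  have P_carrier: "carrier ?P = I \<times> J" by (simp add: RDirProd_carrier)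
  have "group (add_monoid ?P)"
    using subgroup.subgroup_is_group[OF I(1) add_group] subgroup.subgroup_is_group[OF J(1) add_group]
    by (simp only: RDirProd_add_monoid add_monoid_sub_brace DirProd_group)
  moreover have "?f \<in> hom (add_monoid ?P) (add_monoid B)"
  proof (rule homI)
    fix x y assume "x \<in> carrier (add_monoid ?P)" "y \<in> carrier (add_monoid ?P)"
    then obtain i j i' j' where *: "x = (i, j)" "y = (i', j')" "i \<in> I" "j \<in> J" "i' \<in> I" "j' \<in> J"
      by (auto simp: P_carrier)
    \<comment> \<open>Interchange law: only the middle terms \<open>i'\<close> and \<open>j\<close>
      have to change places.\<close>
    have "(i \<oplus> i') \<oplus> (j \<oplus> j') = i \<oplus> (i' \<oplus> j) \<oplus> j'" using * by (simp add: add.m_assoc)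
    also have "\<dots> = (i \<oplus> j) \<oplus> (i' \<oplus> j')" using * comm[of i' j] by (simp add: add.m_assoc)
    finally show "?f (x \<otimes>\<^bsub>add_monoid ?P\<^esub> y) = ?f x \<otimes>\<^bsub>add_monoid B\<^esub> ?f y" using * by (simp add: RDirProd_simps)
  qed (auto simp: P_carrier)
  ultimately have add_hom: "group_hom (add_monoid ?P) (add_monoid B) ?f"
    using add_group by (simp add: group_hom_def group_hom_axioms_def)
  have mult_hom: "?f \<in> hom ?P B"
  proof (rule homI)
    fix x y assume "x \<in> carrier ?P" "y \<in> carrier ?P"
    then obtain i j i' j' where *: "x = (i, j)" "y = (i', j')" "i \<in> I" "j \<in> J" "i' \<in> I" "j' \<in> J"
      by (auto simp: P_carrier)
    \<comment> \<open>The outer sum has one term in \<open>I\<close> and one in \<open>J\<close>, so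
      it is a product. The interchange then happens in the multiplicative group, and the mixed
      products are turned back into sums at the end.\<close>
    have "(i \<otimes> i') \<oplus> (j \<otimes> j') = (i \<otimes> i') \<otimes> (j \<otimes> j')" using * by (simp add: IJ I_mult J_mult)
    also have "\<dots> = i \<otimes> (i' \<otimes> j) \<otimes> j'" using * by (simp add: m_assoc)
    also have "\<dots> = i \<otimes> (j \<otimes> i') \<otimes> j'" using * by (simp only: IJ JI)
    also have "\<dots> = (i \<otimes> j) \<otimes> (i' \<otimes> j')" using * by (simp add: m_assoc)
    also have "\<dots> = (i \<oplus> j) \<otimes> (i' \<oplus> j')" using * by (simp add: IJ)
    finally show "?f (x \<otimes>\<^bsub>?P\<^esub> y) = ?f x \<otimes> ?f y" using * by (simp add: RDirProd_simps)
  qed (auto simp: P_carrier)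
  have "is_skew_brace_iso B (?P Quot a_kernel ?P B ?f)"
  proof (rule first_isomorphism_brace[OF add_hom mult_hom])
    show "x \<otimes>\<^bsub>?P\<^esub> y \<in> carrier ?P" if "x \<in> carrier ?P" "y \<in> carrier ?P" for x y
      using that by (auto simp: P_carrier RDirProd_simps I_mult J_mult)
    show "?f ` carrier ?P = carrier B"
      unfolding P_carrier sum set_add_def' by force
  qed
  moreover have "a_kernel ?P B ?f = {(i, \<ominus> i) | i. i \<in> I \<inter> J}"
  proof -
    have "j = \<ominus> i \<and> i \<in> J" if "i \<in> I" "j \<in> J" "i \<oplus> j = \<zero>" for i j
    proof -
      \<comment> \<open>Being the negative of an element of \<open>J\<close>, the component
        \<open>i\<close> lies in \<open>J\<close> too; this is how the kernel comes to be indexed by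
        the intersection.\<close>
      have "\<ominus> j = i" using that by (simp add: add.inv_equality)
      then show ?thesis using that J_minus by auto
    qed
    then show ?thesis by (auto simp: a_kernel_def kernel_def P_carrier J_minus)
  qed
  ultimately show ?thesis by simp
qed

end

text \<open>The first conjunct certifies that the external central product is formed from legitimate
  data. The other two describe one quotient, with negation taken in the factor \<open>J\<close> and
  in \<open>B\<close> respectively.\<close>

theorem proposition2:
  fixes B :: "('a, 'm) ring_scheme" and I J :: "'a set"
  assumes "skew_brace B"
    and "finite (carrier B)"
    and "brace_ideal I B" and "brace_ideal J B"
    and "internal_central_product B I J"
  shows "amalgamation_data (sub_brace B I) (sub_brace B J) (I \<inter> J) (I \<inter> J) id \<and>
    is_skew_brace_iso B
      (external_central_product (sub_brace B I) (sub_brace B J) (I \<inter> J) id) \<and>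
    is_skew_brace_iso B
      (RDirProd (sub_brace B I) (sub_brace B J) Quot {(i, \<ominus>\<^bsub>B\<^esub> i) | i. i \<in> I \<inter> J})"
proof -
  interpret skew_brace B by (rule assms(1))
  have sub: "subgroup I (add_monoid B)" "subgroup I B" "subgroup J (add_monoid B)" "subgroup J B"
    using assms(3,4) by (auto simp: brace_ideal_def normal_imp_subgroup)
  have center: "I \<inter> J \<subseteq> brace_center B"
    using assms(5) by (simp add: internal_central_product_def)
  have "central_ideal (I \<inter> J) (sub_brace B J)"
    using central_ideal_sub_brace[OF assms(4,3)] center by (simp add: Int_commute)
  \<comment> \<open>Both nested restrictions have the carrier \<open>I \<inter> J\<close> and the
    operations of \<open>B\<close>.\<close>
  moreover have "id \<in> skew_brace_iso (sub_brace (sub_brace B I) (I \<inter> J))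
      (sub_brace (sub_brace B J) (I \<inter> J))"
    by (auto simp: skew_brace_iso_def iso_def hom_def)
  ultimately have "amalgamation_data (sub_brace B I) (sub_brace B J) (I \<inter> J) (I \<inter> J) id"
    using central_ideal_sub_brace[OF assms(3,4) center]
    by (simp add: amalgamation_data_def skew_brace_sub_brace sub)
  \<comment> \<open>Negation in the second factor agrees with negation in \<open>B\<close>, which
    identifies the amalgamated ideal with the kernel found above.\<close>
  moreover have "amalgamation_ideal (sub_brace B J) (I \<inter> J) id = {(i, \<ominus>\<^bsub>B\<^esub> i) | i. i \<in> I \<inter> J}"
    by (auto simp: amalgamation_ideal_def sub_brace_a_inv[OF sub(3)])
  ultimately show ?thesis
    using central_product_iso[OF assms(5)] by (simp add: external_central_product_def)
qed

end
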